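(* Let $N\ge 1$. For every $\xi^{(N)}\in\mathbb{R}^{N+1}\times\mathbb{R}\times\mathbb{R}^{N+1}$, the unique saddle point $(\bar u^N(\xi^{(N)}),\bar v^{(N)}(\xi^{(N)}))$ of $H_N(\xi^{(N)},\cdot,\cdot):U\times V^N\to\mathbb{R}$ is of the form $$(\bar u^N(\xi^{(N)}),\ \bar v^{(N)}(\xi^{(N)}))=\big(\tilde u^N(\xi^{(N)}),\ \tilde v^{(N)}(\xi^{(N)},\tilde u^N(\xi^{(N)}))\big),$$ i.e., it corresponds to a Stackelberg feedback strategy for a 2-player zero-sum game with the major player (choosing $u$, maximizing) as leader and the collectively acting minor agents (choosing $v^{(N)}$, minimizing) as followers.
   Context: Let $U=\mathbb{R}^k$, $V=\mathbb{R}^q$ with Euclidean inner product $(\cdot,\cdot)$ (also written $\cdot$) and norm. Standing assumptions: (1) $f=f(x_0,x_1,y,z_0,z_1,u,v):\mathbb{R}^5\times U\times V\to\mathbb{R}$ is continuous, with $f(\xi,\cdot,\cdot)\in C^1$ for every $\xi=(\eta,z_1)\in\mathbb{R}^5$, $\eta=(x_0,x_1,y,z_0)\in\mathbb{R}^4$. There are constants $C>0$ and $0<\mu<\lambda$ such that for all $\xi=(\eta,z_1),\xi'=(\eta',z_1')\in\mathbb{R}^5$, $(u,v),(u',v')\in U\times V$: (Ai) $(D_uf(\xi,u,v)-D_uf(\xi,u',v),u-u')\le-\lambda|u-u'|^2$ and $(D_vf(\xi,u,v)-D_vf(\xi,u,v'),v-v')\ge\lambda|v-v'|^2$; (Aii)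 $|f(\xi,0,0)|\le C$; $|f(\xi,u,v)-f(\xi',u,v)|\le C|\xi-\xi'|$; $|D_uf(\xi,u,v)-D_uf(\xi',u',v')|\le C(|\xi-\xi'|+|u-u'|)+\mu|v-v'|$, $|D_uf(\xi,0,0)|\le C$; $|D_vf(\xi,u,v)-D_vf(\xi',u',v')|\le C(|\eta-\eta'|+|v-v'|)+\mu|u-u'|$, $|D_vf(\xi,0,0)|\le C$. (2) $b_0:\mathbb{R}^3\to U$, $b_1:\mathbb{R}^3\to V$ are bounded and continuous, and $(x_0,x_1,z)\mapsto b_i(x_0,x_1,z)z$ is bounded and Lipschitz, $i=0,1$. Let $\varepsilon_N>0$, $N\ge1$, be a sequence converging to $0$. For $\xi^{(N)}=(x^{(N)}=(x_0,\dots,x_N),y,z^{(N)}=(z_0,\dots,z_N))\in\mathbb{R}^{N+1}\times\mathbb{R}\times\mathbb{R}^{N+1}$, $u\in U$, $v^{(N)}=(v_1,\dots,v_N)\in V^N$, set $$H_N(\xi^{(N)},u,v^{(N)})=\frac1N\sum_{\ell=1}^Nf(x_0,x_\ell,y,z_0,z_\ell,u,v_\ell)+\Big(\frac1N\sum_{\ell=1}^Nb_0(x_0,x_\ell,z_0)\cdot u\Big)z_0+\varepsilon_N\sum_{i=1}^N\Big(\frac1N\sum_{\ell=1}^Nb_1(x_0,x_\ell,z_i)\cdot v_\ell\Big)z_i.$$ Under the assumptions, for each $\xi^{(N)}$ the function $H_N(\xi^{(N)},\cdot,\cdot)$ has a unique saddle point $(\bar u^N(\xi^{(N)}),\bar v^{(N)}(\xi^{(N)}))$,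 i.e. $H_N(\xi^{(N)},u,\bar v^{(N)}(\xi^{(N)}))\le H_N(\xi^{(N)},\bar u^N(\xi^{(N)}),\bar v^{(N)}(\xi^{(N)}))\le H_N(\xi^{(N)},\bar u^N(\xi^{(N)}),v^{(N)})$ for all $(u,v^{(N)})\in U\times V^N$. $\tilde v^{(N)}:\mathbb{R}^{N+1}\times\mathbb{R}\times\mathbb{R}^{N+1}\times U\to V^N$ is a Borel measurable function with $H_N(\xi^{(N)},u,\tilde v^{(N)}(\xi^{(N)},u))=\inf_{v^{(N)}\in V^N}H_N(\xi^{(N)},u,v^{(N)})$ for all $(\xi^{(N)},u)$, and $\tilde u^N:\mathbb{R}^{N+1}\times\mathbb{R}\times\mathbb{R}^{N+1}\to U$ is a measurable function with $H_N(\xi^{(N)},\tilde u^N(\xi^{(N)}),\tilde v^{(N)}(\xi^{(N)},\tilde u^N(\xi^{(N)})))=\sup_{u\in U}H_N(\xi^{(N)},u,\tilde v^{(N)}(\xi^{(N)},u))$ for all $\xi^{(N)}$. *)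

theory Defs
  imports "HOL-Analysis.Analysis"
begin

definition grad :: "('a::real_inner \<Rightarrow> real) \<Rightarrow> 'a \<Rightarrow> 'a" where
  "grad h x = (THE g. GDERIV h x :> g)"

lemma grad_eqI: "grad h x = g" if "GDERIV h x :> g"
  unfolding grad_def
proof (rule the_equality, rule that)
  fix g' assume "GDERIV h x :> g'"
  with that have "(\<lambda>y. y \<bullet> g') = (\<lambda>y. y \<bullet> g)"
    unfolding gderiv_def by (intro has_derivative_unique)
  then have "(g' - g) \<bullet> g' = (g' - g) \<bullet> g"
    by (rule fun_cong)
  then have "(g' - g) \<bullet> (g' - g) = 0"
    by (simp add: inner_diff_right)
  then show "g' = g"
    by simp
qed

definition C1_fun :: "('a::real_inner \<Rightarrow> real) \<Rightarrow> bool" where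
  "C1_fun h \<longleftrightarrow> (\<exists>D. (\<forall>x. GDERIV h x :> D x) \<and> continuous_on UNIV D)"

text \<open>
  A point of the five-dimensional parameter space is \<open>\<xi> = (\<eta>, z\<^sub>1)\<close> with \<open>\<eta> = (x\<^sub>0, x\<^sub>1, y, z\<^sub>0)\<close>.
  The norm on (nested) product types is the Euclidean one.
\<close>

type_synonym eta = "real \<times> real \<times> real \<times> real"
type_synonym param = "eta \<times> real"

definition Du :: "(param \<Rightarrow> 'u::real_inner \<Rightarrow> 'v \<Rightarrow> real) \<Rightarrow> param \<Rightarrow> 'u \<Rightarrow> 'v \<Rightarrow> 'u" where
  "Du f \<xi> u v = grad (\<lambda>u'. f \<xi> u' v) u"

definition Dv :: "(param \<Rightarrow> 'u \<Rightarrow> 'v::real_inner \<Rightarrow> real) \<Rightarrow> param \<Rightarrow> 'u \<Rightarrow> 'v \<Rightarrow> 'v" where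
  "Dv f \<xi> u v = grad (\<lambda>v'. f \<xi> u v') v"

definition f_regular :: "(param \<Rightarrow> 'u::real_inner \<Rightarrow> 'v::real_inner \<Rightarrow> real) \<Rightarrow> bool" where
  "f_regular f \<longleftrightarrow>
     continuous_on UNIV (\<lambda>(\<xi>, u, v). f \<xi> u v) \<and>
     (\<forall>\<xi>. C1_fun (\<lambda>(u, v). f \<xi> u v))"

definition f_monotone :: "(param \<Rightarrow> 'u::real_inner \<Rightarrow> 'v::real_inner \<Rightarrow> real) \<Rightarrow> real \<Rightarrow> bool" where
  "f_monotone f lam \<longleftrightarrow>
     (\<forall>\<xi> u u' v. (Du f \<xi> u v - Du f \<xi> u' v) \<bullet> (u - u') \<le> - lam * (norm (u - u'))\<^sup>2) \<and>
     (\<forall>\<xi> u v v'. (Dv f \<xi> u v - Dv f \<xi> u v') \<bullet> (v - v') \<ge> lam * (norm (v - v'))\<^sup>2)"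

definition f_lipschitz ::
  "(param \<Rightarrow> 'u::real_inner \<Rightarrow> 'v::real_inner \<Rightarrow> real) \<Rightarrow> real \<Rightarrow> real \<Rightarrow> bool" where
  "f_lipschitz f C mu \<longleftrightarrow>
     (\<forall>\<xi>. \<bar>f \<xi> 0 0\<bar> \<le> C) \<and>
     (\<forall>\<xi> \<xi>' u v. \<bar>f \<xi> u v - f \<xi>' u v\<bar> \<le> C * norm (\<xi> - \<xi>')) \<and>
     (\<forall>\<xi> \<xi>' u u' v v'. norm (Du f \<xi> u v - Du f \<xi>' u' v')
        \<le> C * (norm (\<xi> - \<xi>') + norm (u - u')) + mu * norm (v - v')) \<and>
     (\<forall>\<xi>. norm (Du f \<xi> 0 0) \<le> C) \<and>
     (\<forall>\<eta> z \<eta>' z' u u' v v'. norm (Dv f (\<eta>, z) u v - Dv f (\<eta>', z') u' v')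
        \<le> C * (norm (\<eta> - \<eta>') + norm (v - v')) + mu * norm (u - u')) \<and>
     (\<forall>\<xi>. norm (Dv f \<xi> 0 0) \<le> C)"

definition b_admissible :: "(real \<times> real \<times> real \<Rightarrow> 'a::real_normed_vector) \<Rightarrow> bool" where
  "b_admissible b \<longleftrightarrow>
     bounded (range b) \<and> continuous_on UNIV b \<and>
     bounded (range (\<lambda>(x0, x1, z). z *\<^sub>R b (x0, x1, z))) \<and>
     (\<exists>L. L-lipschitz_on UNIV (\<lambda>(x0, x1, z). z *\<^sub>R b (x0, x1, z)))"

text \<open>
  The number \<open>N \<ge> 1\<close> of minor agents is \<open>CARD('n)\<close> for a finite type \<open>'n\<close> indexing the agents
  \<open>1, \<dots>, N\<close>.  The vectors \<open>(x\<^sub>0, \<dots>, x\<^sub>N)\<close> and \<open>(z\<^sub>0, \<dots>, z\<^sub>N)\<close> are pairs consisting of the major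
  player's component (index 0) and a vector indexed by \<open>'n\<close>.
\<close>

type_synonym 'n state = "(real \<times> (real ^ 'n)) \<times> real \<times> (real \<times> (real ^ 'n))"

definition HN ::
  "(param \<Rightarrow> 'u \<Rightarrow> 'v \<Rightarrow> real) \<Rightarrow> (real \<times> real \<times> real \<Rightarrow> 'u::real_inner)
    \<Rightarrow> (real \<times> real \<times> real \<Rightarrow> 'v::real_inner) \<Rightarrow> (nat \<Rightarrow> real)
    \<Rightarrow> 'n::finite state \<Rightarrow> 'u \<Rightarrow> 'v ^ 'n \<Rightarrow> real" where
  "HN f b0 b1 eps = (\<lambda>((x0, x), y, (z0, z)) u v.
      1 / real CARD('n) * (\<Sum>l\<in>UNIV. f ((x0, x $ l, y, z0), z $ l) u (v $ l))
    + (1 / real CARD('n) * (\<Sum>l\<in>UNIV. b0 (x0, x $ l, z0) \<bullet> u)) * z0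
    + eps CARD('n) *
        (\<Sum>i\<in>UNIV. (1 / real CARD('n) * (\<Sum>l\<in>UNIV. b1 (x0, x $ l, z $ i) \<bullet> (v $ l))) * z $ i))"

definition is_saddle_point :: "('u \<Rightarrow> 'w \<Rightarrow> real) \<Rightarrow> 'u \<times> 'w \<Rightarrow> bool" where
  "is_saddle_point H = (\<lambda>(ub, vb). \<forall>u v. H u vb \<le> H ub vb \<and> H ub vb \<le> H ub v)"

text \<open>
  The infimum and supremum are taken in the extended reals, so that the equations are
  meaningful without a separate boundedness condition.
\<close>

definition follower_response ::
  "('s \<Rightarrow> 'u \<Rightarrow> 'w \<Rightarrow> real) \<Rightarrow> ('s \<times> 'u \<Rightarrow> 'w) \<Rightarrow> bool" where
  "follower_response H vt \<longleftrightarrow>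
     (\<forall>\<xi> u. ereal (H \<xi> u (vt (\<xi>, u))) = (INF v. ereal (H \<xi> u v)))"

definition leader_optimal ::
  "('s \<Rightarrow> 'u \<Rightarrow> 'w \<Rightarrow> real) \<Rightarrow> ('s \<times> 'u \<Rightarrow> 'w) \<Rightarrow> ('s \<Rightarrow> 'u) \<Rightarrow> bool" where
  "leader_optimal H vt ut \<longleftrightarrow>
     (\<forall>\<xi>. ereal (H \<xi> (ut \<xi>) (vt (\<xi>, ut \<xi>))) = (SUP u. ereal (H \<xi> u (vt (\<xi>, u)))))"

end

theory Submission
  imports Defs
begin

text \<open>
  Fix \<open>\<xi>\<close> and write \<open>H\<close> for the Hamiltonian, \<open>r u\<close> for the followers' reply to \<open>u\<close> and \<open>a\<close> for
  the leader's choice.  \<open>H\<close> is strongly concave in \<open>u\<close> and strongly convex in \<open>v\<close>.  For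
  \<open>0 < t < 1\<close> and \<open>w = r ((1 - t) a + t u)\<close>, concavity in \<open>u\<close> and optimality of \<open>a\<close> give
  \<open>(1 - t) H a w + t H u w \<le> H a (r a)\<close>.  Bounding \<open>H a w\<close> from below by quadratic growth around
  \<open>r a\<close> and \<open>H u w\<close> by \<open>H u (r u)\<close> shows that \<open>w\<close> tends to \<open>r a\<close> as \<open>t\<close> tends to \<open>0\<close>; bounding
  \<open>H a w\<close> by \<open>H a (r a)\<close> gives \<open>H u w \<le> H a (r a)\<close>, and the limit is the saddle inequality.
\<close>

section \<open>Strong convexity and its consequences for minimizers\<close>

text \<open>The modulus is normalized without a factor 1/2, and \<open>m = 0\<close> is plain
  convexity. Sums and nonnegative multiples thus reduce to those of convex functions.\<close>

definition strongly_convex :: "real \<Rightarrow> ('a::real_inner \<Rightarrow> real) \<Rightarrow> bool" where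
  "strongly_convex m g \<longleftrightarrow> convex_on UNIV (\<lambda>x. g x - m * (norm x)\<^sup>2)"

lemma strongly_convex_midpoint:
  assumes "strongly_convex m g"
  shows "g ((1/2) *\<^sub>R x + (1/2) *\<^sub>R y) \<le> g x / 2 + g y / 2 - m / 4 * (norm (x - y))\<^sup>2"
proof -
  have par: "(norm ((1/2) *\<^sub>R x + (1/2) *\<^sub>R y))\<^sup>2
      = (norm x)\<^sup>2 / 2 + (norm y)\<^sup>2 / 2 - (norm (x - y))\<^sup>2 / 4"
    by (simp add: power2_norm_eq_inner inner_add_left inner_add_right inner_diff_left
        inner_diff_right inner_commute field_simps)
  have "g ((1/2) *\<^sub>R x + (1/2) *\<^sub>R y) - m * (norm ((1/2) *\<^sub>R x + (1/2) *\<^sub>R y))\<^sup>2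
      \<le> (1/2) * (g x - m * (norm x)\<^sup>2) + (1/2) * (g y - m * (norm y)\<^sup>2)"
    using convex_onD[OF assms[unfolded strongly_convex_def], of "1/2" x y] by simp
  then show ?thesis
    unfolding par by (simp add: algebra_simps)
qed

text \<open>The midpoint of \<open>x\<close> and \<open>y\<close> has value at least
  \<open>g x\<close>; insert this in the midpoint inequality. The weight 1/2 is why the constant is
  \<open>m / 2\<close> rather than \<open>m\<close>.\<close>

lemma strongly_convex_growth:
  assumes sc: "strongly_convex m g" and min: "\<And>y. g x \<le> g y"
  shows "g x + m / 2 * (norm (y - x))\<^sup>2 \<le> g y"
  using strongly_convex_midpoint[OF sc, of x y] min[of "(1/2) *\<^sub>R x + (1/2) *\<^sub>R y"]
  by (simp add: norm_minus_commute)

lemma strongly_convex_min_unique: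
  assumes "strongly_convex m g" and "m > 0"
    and "\<And>y. g x \<le> g y" and "g x' \<le> g x"
  shows "x' = x"
proof -
  have "m / 2 * (norm (x' - x))\<^sup>2 \<le> 0"
    using strongly_convex_growth[OF assms(1,3), of x'] assms(4) by linarith
  then show ?thesis
    using \<open>m > 0\<close> by (simp add: mult_le_0_iff)
qed

text \<open>On each line \<open>x + s *\<^sub>R d\<close> monotonicity makes the derivative
  \<open>D (x + s *\<^sub>R d) \<bullet> d\<close> nondecreasing in \<open>s\<close>, which is
  convexity in one real variable.\<close>

lemma convex_on_of_monotone_gradient:
  fixes h :: "'a::real_inner \<Rightarrow> real"
  assumes D: "\<And>x. GDERIV h x :> D x"
    and mono: "\<And>x y. (D x - D y) \<bullet> (x - y) \<ge> 0"
  shows "convex_on UNIV h"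
proof (rule convex_onI)
  fix t :: real and x y :: 'a
  assume t: "0 < t" "t < 1"
  define d where "d = y - x"
  have der: "((\<lambda>s. h (x + s *\<^sub>R d)) has_real_derivative D (x + s *\<^sub>R d) \<bullet> d) (at s)" for s
  proof -
    have "((\<lambda>s. x + s *\<^sub>R d) has_derivative (\<lambda>s. s *\<^sub>R d)) (at s)"
      by (auto intro!: derivative_eq_intros)
    from has_derivative_compose[OF this D[unfolded gderiv_def]]
    show ?thesis
      by (rule has_derivative_imp_has_field_derivative) (simp add: inner_commute mult.commute)
  qed
  have "convex_on UNIV (\<lambda>s. h (x + s *\<^sub>R d))"
  proof (rule convex_on_realI[OF connected_UNIV])
    fix r s :: real assume "r \<le> s"
    \<comment> \<open>The two points differ by \<open>(s - r) *\<^sub>R d\<close>, so the factor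
      \<open>s - r\<close> splits off and can be cancelled unless \<open>r = s\<close>.\<close>
    have "(s - r) * ((D (x + s *\<^sub>R d) - D (x + r *\<^sub>R d)) \<bullet> d) \<ge> 0"
      using mono[of "x + s *\<^sub>R d" "x + r *\<^sub>R d"] by (simp flip: scaleR_diff_left)
    then show "D (x + r *\<^sub>R d) \<bullet> d \<le> D (x + s *\<^sub>R d) \<bullet> d"
      using \<open>r \<le> s\<close> by (cases "r = s") (auto simp: zero_le_mult_iff inner_diff_left)
  qed (use der in auto)
  from convex_onD[OF this, of t 0 1]
  have "h (x + t *\<^sub>R d) \<le> (1 - t) * h x + t * h y"
    using t by (simp add: d_def)
  moreover have "x + t *\<^sub>R d = (1 - t) *\<^sub>R x + t *\<^sub>R y"
    by (simp add: d_def algebra_simps)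
  ultimately show "h ((1 - t) *\<^sub>R x + t *\<^sub>R y) \<le> (1 - t) * h x + t * h y"
    by simp
qed simp

lemma strongly_convex_imp_convex:
  assumes "strongly_convex m g" and "m \<ge> 0"
  shows "convex_on UNIV g"
proof -
  have "convex_on UNIV (\<lambda>x :: 'a. (norm x)\<^sup>2)"
  proof (rule convex_on_of_monotone_gradient)
    show "GDERIV (\<lambda>x. (norm x)\<^sup>2) x :> 2 *\<^sub>R x" for x :: 'a
      unfolding gderiv_def power2_norm_eq_inner
      by (auto intro!: derivative_eq_intros simp: inner_commute)
    show "(2 *\<^sub>R x - 2 *\<^sub>R y) \<bullet> (x - y) \<ge> 0" for x y :: 'a
      by (simp flip: scaleR_diff_right)
  qed
  then have "convex_on UNIV (\<lambda>x. (g x - m * (norm x)\<^sup>2) + m * (norm x)\<^sup>2)"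
    using assms by (intro convex_on_add convex_on_cmul) (auto simp: strongly_convex_def)
  then show ?thesis by simp
qed

text \<open>The modulus is \<open>lam / 2\<close> because \<open>lam / 2 * (norm x)\<^sup>2\<close>
  has gradient \<open>lam *\<^sub>R x\<close>; subtracting it leaves a monotone gradient.\<close>

lemma strongly_convex_of_gradient:
  assumes D: "\<And>x. GDERIV g x :> D x"
    and mono: "\<And>x y. (D x - D y) \<bullet> (x - y) \<ge> lam * (norm (x - y))\<^sup>2"
  shows "strongly_convex (lam / 2) g"
  unfolding strongly_convex_def
proof (rule convex_on_of_monotone_gradient)
  show "GDERIV (\<lambda>x. g x - lam / 2 * (norm x)\<^sup>2) x :> D x - lam *\<^sub>R x" for x
    unfolding gderiv_def power2_norm_eq_inner
    by (auto intro!: derivative_eq_intros D[unfolded gderiv_def]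
        simp: inner_diff_right inner_commute)
  show "(D x - lam *\<^sub>R x - (D y - lam *\<^sub>R y)) \<bullet> (x - y) \<ge> 0" for x y
    using mono[of x y]
    by (simp add: power2_norm_eq_inner inner_diff_left inner_diff_right algebra_simps)
qed

section \<open>Sums, multiples and linear perturbations\<close>

lemma strongly_convex_add:
  assumes "strongly_convex m g" and "strongly_convex m' h"
  shows "strongly_convex (m + m') (\<lambda>x. g x + h x)"
  using convex_on_add[OF assms[unfolded strongly_convex_def]]
  by (simp add: strongly_convex_def algebra_simps)

lemma strongly_convex_cmul:
  assumes "strongly_convex m g" and "c \<ge> 0"
  shows "strongly_convex (c * m) (\<lambda>x. c * g x)"
  using convex_on_cmul[OF assms(2) assms(1)[unfolded strongly_convex_def]]
  by (simp add: strongly_convex_def algebra_simps)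

lemma linear_imp_convex_on:
  fixes L :: "'a::real_vector \<Rightarrow> real"
  assumes "linear L"
  shows "convex_on UNIV L"
  by (rule convex_onI) (simp_all add: linear_add[OF assms] linear_scale[OF assms])

lemma strongly_convex_linear:
  assumes "linear L"
  shows "strongly_convex 0 L"
  using linear_imp_convex_on[OF assms] by (simp add: strongly_convex_def)

lemma convex_on_sum_UNIV:
  fixes g :: "'n::finite \<Rightarrow> 'a::real_vector \<Rightarrow> real"
  assumes "\<And>l. convex_on UNIV (g l)"
  shows "convex_on UNIV (\<lambda>x. \<Sum>l\<in>UNIV. g l x)"
  by (rule convex_onI)
    (simp_all add: sum_distrib_left sum.distrib[symmetric] sum_mono convex_onD[OF assms])

lemma strongly_convex_sum:
  fixes g :: "'n::finite \<Rightarrow> 'a::real_inner \<Rightarrow> real"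
  assumes "\<And>l. strongly_convex m (g l)"
  shows "strongly_convex (real CARD('n) * m) (\<lambda>x. \<Sum>l\<in>UNIV. g l x)"
  using convex_on_sum_UNIV[of "\<lambda>l x. g l x - m * (norm x)\<^sup>2"] assms
  by (simp add: strongly_convex_def sum_subtractf mult.assoc)

text \<open>The squared norm of \<open>x\<close> is the sum of those of its components, so the
  modulus stays \<open>m\<close>; summands sharing one variable would add their moduli
  instead.\<close>

lemma strongly_convex_separable_sum:
  fixes g :: "'n::finite \<Rightarrow> 'a::real_inner \<Rightarrow> real"
  assumes "\<And>l. strongly_convex m (g l)"
  shows "strongly_convex m (\<lambda>x :: 'a ^ 'n. \<Sum>l\<in>UNIV. g l (x $ l))"
proof -
  have "convex_on UNIV (\<lambda>x :: 'a ^ 'n. g l (x $ l) - m * (norm (x $ l))\<^sup>2)" for l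
    using convex_onD[OF assms[unfolded strongly_convex_def, of l]]
    by (intro convex_onI) auto
  from convex_on_sum_UNIV[OF this] show ?thesis
    by (simp add: strongly_convex_def sum_subtractf sum_distrib_left norm_vec_def
        L2_set_def sum_nonneg)
qed

section \<open>Saddle points: Stackelberg pairs and uniqueness\<close>

lemma stackelberg_imp_saddle_point:
  fixes H :: "'u::real_vector \<Rightarrow> 'w::euclidean_space \<Rightarrow> real"
  assumes concave: "\<And>v. convex_on UNIV (\<lambda>u. - H u v)"
    and sc: "\<And>u. strongly_convex m (H u)" and "m > 0"
    and reply: "\<And>u v. H u (r u) \<le> H u v"
    and lead: "\<And>u. H u (r u) \<le> H a (r a)"
  shows "is_saddle_point H (a, r a)"
proof -
  have "H u (r a) \<le> H a (r a)" for u
  proof -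
    define w where "w t = r ((1 - t) *\<^sub>R a + t *\<^sub>R u)" for t
    have mix: "(1 - t) * H a (w t) + t * H u (w t) \<le> H a (r a)" if "0 < t" "t < 1" for t
      using convex_onD[OF concave, of t a u "w t"] lead[of "(1 - t) *\<^sub>R a + t *\<^sub>R u"] that
      by (simp add: w_def)
    have le: "H u (w t) \<le> H a (r a)" if "0 < t" "t < 1" for t
    proof -
      have "(1 - t) * H a (r a) \<le> (1 - t) * H a (w t)"
        using that reply by (intro mult_left_mono) auto
      with mix[OF that] have "t * H u (w t) \<le> t * H a (r a)"
        by (simp add: algebra_simps)
      then show ?thesis using that by simp
    qed
    define K where "K = H a (r a) - H u (r u)"
    \<comment> \<open>Lower bounds for both terms of \<open>mix\<close> cancel the multiples of
      \<open>H a (r a)\<close> up to \<open>t * K\<close>. The replies \<open>w t\<close> thus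
      approach \<open>r a\<close> at rate \<open>sqrt t\<close>, although \<open>r\<close> is an
      arbitrary selection of minimizers.\<close>
    have bound: "(norm (w t - r a))\<^sup>2 \<le> t / (1 - t) * (2 * K / m)" if "0 < t" "t < 1" for t
    proof -
      have "(1 - t) * (H a (r a) + m / 2 * (norm (w t - r a))\<^sup>2) \<le> (1 - t) * H a (w t)"
        using that by (intro mult_left_mono strongly_convex_growth[OF sc reply]) auto
      moreover have "t * H u (r u) \<le> t * H u (w t)"
        using that reply by (intro mult_left_mono) auto
      ultimately have "(1 - t) * (m / 2 * (norm (w t - r a))\<^sup>2) \<le> t * K"
        using mix[OF that] by (simp add: K_def algebra_simps)
      then show ?thesis
        using that \<open>m > 0\<close> by (simp add: field_simps)
    qed
    have ev: "\<forall>\<^sub>F t in at_right (0::real). 0 < t \<and> t < 1"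
      by (auto simp: eventually_at_right_field intro: exI[of _ 1])
    have "((\<lambda>t. t / (1 - t) * (2 * K / m)) \<longlongrightarrow> 0 / (1 - 0) * (2 * K / m)) (at_right 0)"
      by (intro tendsto_intros) auto
    then have "((\<lambda>t. t / (1 - t) * (2 * K / m)) \<longlongrightarrow> 0) (at_right 0)"
      by simp
    then have "((\<lambda>t. (norm (w t - r a))\<^sup>2) \<longlongrightarrow> 0) (at_right 0)"
      by (rule tendsto_sandwich[OF _ _ tendsto_const, rotated 2])
        (use eventually_mono[OF ev bound] in simp_all)
    then have "((\<lambda>t. sqrt ((norm (w t - r a))\<^sup>2)) \<longlongrightarrow> sqrt 0) (at_right 0)"
      by (rule tendsto_real_sqrt)
    then have w: "(w \<longlongrightarrow> r a) (at_right 0)"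
      by (simp add: tendsto_norm_zero_iff LIM_zero_iff)
    \<comment> \<open>A finite convex function on a Euclidean space is continuous; here the finite
      dimension of the followers' space enters.\<close>
    have "continuous_on UNIV (H u)"
      using strongly_convex_imp_convex[OF sc] \<open>m > 0\<close>
      by (intro convex_on_continuous) auto
    then have "((\<lambda>t. H u (w t)) \<longlongrightarrow> H u (r a)) (at_right 0)"
      by (intro continuous_on_tendsto_compose[OF _ w]) auto
    then show ?thesis
      by (rule tendsto_upperbound) (simp_all add: eventually_mono[OF ev] le)
  qed
  then show ?thesis
    using reply by (simp add: is_saddle_point_def)
qed

text \<open>For saddle points \<open>(a, b)\<close> and \<open>(a', b')\<close> the cycle
  \<open>H a b \<le> H a b' \<le> H a' b' \<le> H a' b \<le> H a b\<close> forces equality. So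
  \<open>a'\<close> also maximizes against \<open>b\<close> and \<open>b'\<close> also minimizes
  against \<open>a\<close>, and these optimizers are unique.\<close>

lemma saddle_point_unique:
  fixes H :: "'u::real_inner \<Rightarrow> 'w::real_inner \<Rightarrow> real"
  assumes scu: "\<And>v. strongly_convex m (\<lambda>u. - H u v)" and scv: "\<And>u. strongly_convex m' (H u)"
    and "m > 0" "m' > 0"
    and p: "is_saddle_point H p" and q: "is_saddle_point H q"
  shows "p = q"
proof -
  obtain a b a' b' where eq: "p = (a, b)" "q = (a', b')"
    by (meson surj_pair)
  have s: "H u b \<le> H a b" "H a b \<le> H a v" "H u b' \<le> H a' b'" "H a' b' \<le> H a' v" for u v
    using p q by (auto simp: eq is_saddle_point_def)
  have "a' = a"
    by (rule strongly_convex_min_unique[OF scu \<open>m > 0\<close>, where v1 = b])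
      (use s(1) s(2)[of b'] s(3)[of a] s(4)[of b] in auto)
  moreover have "b' = b"
    by (rule strongly_convex_min_unique[OF scv \<open>m' > 0\<close>, where u1 = a])
      (use s(2) s(1)[of a'] s(3)[of a] s(4)[of b] in \<open>auto intro: order_trans\<close>)
  ultimately show ?thesis by (simp add: eq)
qed

section \<open>Strong concavity and convexity of the Hamiltonian\<close>

text \<open>The partial gradients are the components of the joint one. As \<open>grad\<close> is a
  definite description, a gradient must be exhibited before the bounds on \<open>Du\<close> and
  \<open>Dv\<close> say anything about derivatives.\<close>

lemma C1_fun_partial_gradients:
  fixes g :: "'u::real_inner \<Rightarrow> 'v::real_inner \<Rightarrow> real"
  assumes "C1_fun (\<lambda>(u, v). g u v)"
  shows "GDERIV (\<lambda>u'. g u' v) u :> grad (\<lambda>u'. g u' v) u"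
    and "GDERIV (\<lambda>v'. g u v') v :> grad (\<lambda>v'. g u v') v"
proof -
  obtain D where D: "\<And>x. GDERIV (\<lambda>(u, v). g u v) x :> D x"
    using assms by (auto simp: C1_fun_def)
  have "((\<lambda>u'. (u', v)) has_derivative (\<lambda>h. (h, 0))) (at u)"
    "((\<lambda>v'. (u, v')) has_derivative (\<lambda>h. (0, h))) (at v)"
    by (auto intro!: derivative_eq_intros)
  from this[THEN has_derivative_compose, OF D[unfolded gderiv_def]]
  have *: "GDERIV (\<lambda>u'. g u' v) u :> fst (D (u, v))" "GDERIV (\<lambda>v'. g u v') v :> snd (D (u, v))"
    by (simp_all add: gderiv_def inner_prod_def)
  show "GDERIV (\<lambda>u'. g u' v) u :> grad (\<lambda>u'. g u' v) u"
    "GDERIV (\<lambda>v'. g u v') v :> grad (\<lambda>v'. g u v') v"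
    using * by (simp_all add: grad_eqI[OF *(1)] grad_eqI[OF *(2)])
qed

lemma f_strongly_convex:
  assumes "f_regular f" and "f_monotone f lam"
  shows "strongly_convex (lam / 2) (\<lambda>u. - f \<xi> u v)" and "strongly_convex (lam / 2) (f \<xi> u)"
proof -
  have D: "GDERIV (\<lambda>u'. f \<xi> u' v) u :> Du f \<xi> u v" "GDERIV (\<lambda>v'. f \<xi> u v') v :> Dv f \<xi> u v" for u v
    using assms(1) C1_fun_partial_gradients[of "f \<xi>"]
    unfolding f_regular_def Du_def Dv_def by blast+
  have mono: "(Du f \<xi> u v - Du f \<xi> u' v) \<bullet> (u - u') \<le> - lam * (norm (u - u'))\<^sup>2"
    "(Dv f \<xi> u v - Dv f \<xi> u v') \<bullet> (v - v') \<ge> lam * (norm (v - v'))\<^sup>2" for u u' v v'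
    using assms(2) unfolding f_monotone_def by blast+
  show "strongly_convex (lam / 2) (\<lambda>u. - f \<xi> u v)"
  proof (rule strongly_convex_of_gradient)
    show "GDERIV (\<lambda>u. - f \<xi> u v) u :> - Du f \<xi> u v" for u
      using D(1) by (rule GDERIV_minus)
    show "(- Du f \<xi> u v - - Du f \<xi> u' v) \<bullet> (u - u') \<ge> lam * (norm (u - u'))\<^sup>2" for u u'
      using mono(1)[of u v u'] by (simp add: inner_diff_left)
  qed
  show "strongly_convex (lam / 2) (f \<xi> u)"
    by (rule strongly_convex_of_gradient[OF D(2) mono(2)])
qed

text \<open>The \<open>b0\<close> and \<open>b1\<close> terms are linear in one variable and
  constant in the other, so they add modulus 0. In \<open>u\<close> the average of functions of the
  same variable keeps \<open>lam / 2\<close>; in \<open>v\<close> each summand sees only its own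
  component, so the factor 1/N remains.\<close>

lemma HN_strongly_convex:
  fixes f :: "param \<Rightarrow> 'u::real_inner \<Rightarrow> 'v::real_inner \<Rightarrow> real" and \<xi> :: "'n::finite state"
  assumes "f_regular f" and "f_monotone f lam"
  shows "strongly_convex (lam / 2) (\<lambda>u. - HN f b0 b1 eps \<xi> u v)"
    and "strongly_convex (lam / (2 * real CARD('n))) (HN f b0 b1 eps \<xi> u)"
proof -
  obtain x0 x y z0 z where \<xi>: "\<xi> = ((x0, x), y, (z0, z))"
    by (metis prod.exhaust)
  let ?n = "real CARD('n)"
  let ?f = "\<lambda>l. f ((x0, x $ l, y, z0), z $ l)"
  let ?A = "\<lambda>u. 1 / ?n * (\<Sum>l\<in>UNIV. b0 (x0, x $ l, z0) \<bullet> u) * z0"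
  let ?B = "\<lambda>v. eps CARD('n) *
        (\<Sum>i\<in>UNIV. (1 / ?n * (\<Sum>l\<in>UNIV. b1 (x0, x $ l, z $ i) \<bullet> (v $ l))) * z $ i)"
  note sc = f_strongly_convex[OF assms]
  have const: "strongly_convex 0 (\<lambda>_. c)" for c
    by (simp add: strongly_convex_def convex_on_const)
  have "linear (\<lambda>u. - ?A u)"
    by (rule linearI)
      (simp_all add: inner_add_right sum.distrib algebra_simps sum_distrib_left add_divide_distrib)
  then have A: "strongly_convex 0 (\<lambda>u. - ?A u)"
    by (rule strongly_convex_linear)
  have "linear ?B"
    by (rule linearI)
      (simp_all add: inner_add_right sum.distrib algebra_simps sum_distrib_left add_divide_distrib)
  then have B: "strongly_convex 0 ?B"
    by (rule strongly_convex_linear)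
  have "strongly_convex (1 / ?n * (?n * (lam / 2)) + 0 + 0)
      (\<lambda>u. 1 / ?n * (\<Sum>l\<in>UNIV. - ?f l u (v $ l)) + - ?A u + - ?B v)"
    by (intro strongly_convex_add strongly_convex_cmul strongly_convex_sum sc A const) simp
  then show "strongly_convex (lam / 2) (\<lambda>u. - HN f b0 b1 eps \<xi> u v)"
    by (simp add: HN_def \<xi> sum_negf)
  have "strongly_convex (1 / ?n * (lam / 2) + 0 + 0)
      (\<lambda>v. 1 / ?n * (\<Sum>l\<in>UNIV. ?f l u (v $ l)) + ?A u + ?B v)"
    by (intro strongly_convex_add strongly_convex_cmul strongly_convex_separable_sum sc B const) simp
  then show "strongly_convex (lam / (2 * ?n)) (HN f b0 b1 eps \<xi> u)"
    by (simp add: HN_def \<xi> mult.commute)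
qed

theorem lemma3p1:
  fixes f :: "param \<Rightarrow> real ^ 'k \<Rightarrow> real ^ 'q \<Rightarrow> real"
    and b0 :: "real \<times> real \<times> real \<Rightarrow> real ^ 'k"
    and b1 :: "real \<times> real \<times> real \<Rightarrow> real ^ 'q"
    and C mu lam :: real
    and eps :: "nat \<Rightarrow> real"
    and vt :: "'n::finite state \<times> (real ^ 'k) \<Rightarrow> (real ^ 'q) ^ 'n"
    and ut :: "'n state \<Rightarrow> real ^ 'k"
  assumes "C > 0" and "0 < mu" and "mu < lam"
    and "f_regular f" and "f_monotone f lam" and "f_lipschitz f C mu"
    and "b_admissible b0" and "b_admissible b1"
    and "\<And>N. N \<ge> 1 \<Longrightarrow> eps N > 0" and "eps \<longlonglongrightarrow> 0"
    and "vt \<in> borel_measurable borel"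
    and "follower_response (HN f b0 b1 eps) vt"
    and "ut \<in> borel_measurable borel"
    and "leader_optimal (HN f b0 b1 eps) vt ut"
  shows "\<forall>\<xi>. (\<exists>!p. is_saddle_point (HN f b0 b1 eps \<xi>) p) \<and>
             (THE p. is_saddle_point (HN f b0 b1 eps \<xi>) p) = (ut \<xi>, vt (\<xi>, ut \<xi>))"
proof
  fix \<xi> :: "'n state"
  let ?H = "HN f b0 b1 eps \<xi>"
  note sc = HN_strongly_convex[OF \<open>f_regular f\<close> \<open>f_monotone f lam\<close>, where \<xi> = \<xi> and ?b0.0 = b0 and ?b1.0 = b1 and eps = eps]
  have pos: "lam / 2 > 0" "lam / (2 * real CARD('n)) > 0"
    using \<open>0 < mu\<close> \<open>mu < lam\<close> by auto
  \<comment> \<open>The infimum is a lower bound of all values, so \<open>vt\<close> selects true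
    minimizers; dually for the supremum and \<open>ut\<close>.\<close>
  have reply: "?H u (vt (\<xi>, u)) \<le> ?H u v" for u v
  proof -
    have "ereal (?H u (vt (\<xi>, u))) \<le> ereal (?H u v)"
      using \<open>follower_response (HN f b0 b1 eps) vt\<close>
      unfolding follower_response_def by (metis INF_lower UNIV_I)
    then show ?thesis by simp
  qed
  have lead: "?H u (vt (\<xi>, u)) \<le> ?H (ut \<xi>) (vt (\<xi>, ut \<xi>))" for u
  proof -
    have "ereal (?H u (vt (\<xi>, u))) \<le> ereal (?H (ut \<xi>) (vt (\<xi>, ut \<xi>)))"
      using \<open>leader_optimal (HN f b0 b1 eps) vt ut\<close>
      unfolding leader_optimal_def by (metis (no_types, lifting) SUP_upper UNIV_I)
    then show ?thesis by simp
  qed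
  \<comment> \<open>The Stackelberg pair is itself the witness for existence, so uniqueness then
    identifies the definite description with it.\<close>
  have saddle: "is_saddle_point ?H (ut \<xi>, vt (\<xi>, ut \<xi>))"
    using strongly_convex_imp_convex[OF sc(1)] pos
    by (intro stackelberg_imp_saddle_point[where r = "\<lambda>u. vt (\<xi>, u)", OF _ sc(2) pos(2) reply lead])
      auto
  moreover have "p = q" if "is_saddle_point ?H p" "is_saddle_point ?H q" for p q
    by (rule saddle_point_unique[OF sc pos that])
  ultimately show "(\<exists>!p. is_saddle_point ?H p) \<and>
      (THE p. is_saddle_point ?H p) = (ut \<xi>, vt (\<xi>, ut \<xi>))"
    by (metis (mono_tags, lifting) the_equality)
qed

end
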